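(* Let $\mathcal{F}$ be a $(p^+)$-filter on $E$. Then whenever $X_{\vec{a}}\in E^{[\infty]}$ with $\langle X_{\vec{a}}\rangle\in\mathcal{F}$ for every $\vec{a}\in\mathrm{FIN}^{[<\infty]}$, there is $X\in E^{[\infty]}$ with $\langle X\rangle\in\mathcal{F}$ such that $X/\vec{a}\preceq X_{\vec{a}}$ whenever $\vec{a}\sqsubseteq\mathrm{supp}(X)$.
   Context: $E$ is a countably infinite-dimensional vector space over a countable field $F$ with fixed basis $(e_n)$; $\mathrm{supp}(v)$ for nonzero $v$ is the set of $i$ with $e_i$ having nonzero coefficient in $v$. A block sequence is a sequence $(x_n)$ of nonzero vectors with $\max\mathrm{supp}(x_n)<\min\mathrm{supp}(x_{n+1})$; $E^{[\infty]}$ the set of infinite block sequences; $\langle X\rangle$ the span minus $0$; $Y\preceq X$ iff $\langle Y\rangle\subseteq\langle X\rangle$; $X/n$ the tail of $X$ of vectors with support above $n$; $Y\preceq^*X$ iff $Y/n\preceq X$ for some $n$. $\mathrm{FIN}$ is the set of nonempty finite subsets of $\omega$, $\mathrm{FIN}^{[<\infty]}$ the set of finite sequences $(a_0,\dots,a_{k-1})$ in $\mathrm{FIN}$ with $\max a_i<\min a_{i+1}$. For $X=(x_n)$, $\mathrm{supp}(X)=(\mathrm{supp}(x_n))$; $\vec{a}\sqsubseteq\mathrm{supp}(X)$ means $\vec a$ is an initial segment of $\mathrm{supp}(X)$; $X/\vec a$ is the tail of $X$ consisting of vectors whose supports lie entirely above all entries of $\vec a$. A filter on $E$ is a proper filter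 of subsets of $E\setminus\{0\}$ containing nonzero parts of all finite-codimensional subspaces; a block filter has a base of sets $\langle X\rangle$. For a block filter $\mathcal{F}$: $D\subseteq E$ is $\mathcal{F}$-dense if for every $\langle X\rangle\in\mathcal{F}$ there is an infinite-dimensional subspace $V\subseteq\langle X\rangle\cup\{0\}$ with $V\setminus\{0\}\subseteq D$; $\mathcal{F}$ is full if every $\mathcal{F}$-dense set is in $\mathcal{F}$; $(p)$-filter: whenever $\langle X_n\rangle\in\mathcal{F}$ for all $n$ there is $\langle X\rangle\in\mathcal{F}$ with $X\preceq^*X_n$ for all $n$; $(p^+)$-filter: full $(p)$-filter. *)

theory Defs
  imports Complex_Main "HOL-Library.Countable_Set"
begin

text \<open>
  \<open>E\<close> is the whole type of vectors; its dimension is countably infinite because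
  the basis \<open>e\<close> is indexed injectively by the natural numbers.  The countable field may be finite.
\<close>

locale block_space = vector_space scale
  for scale :: "'f::field \<Rightarrow> 'v::ab_group_add \<Rightarrow> 'v" +
  fixes e :: "nat \<Rightarrow> 'v"
  assumes countable_field: "countable (UNIV :: 'f set)"
    and inj_basis: "inj e"
    and independent_basis: "independent (range e)"
    and span_basis: "span (range e) = UNIV"
begin

definition supp :: "'v \<Rightarrow> nat set" where
  "supp v = {i. representation (range e) v (e i) \<noteq> 0}"

definition block_seqs :: "(nat \<Rightarrow> 'v) set" where
  "block_seqs = {X. (\<forall>n. X n \<noteq> 0) \<and> (\<forall>n. Max (supp (X n)) < Min (supp (X (Suc n))))}"

definition nzspan :: "(nat \<Rightarrow> 'v) \<Rightarrow> 'v set" where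
  "nzspan X = span (range X) - {0}"

definition block_le :: "(nat \<Rightarrow> 'v) \<Rightarrow> (nat \<Rightarrow> 'v) \<Rightarrow> bool" (infix "\<preceq>" 50) where
  "Y \<preceq> X \<longleftrightarrow> nzspan Y \<subseteq> nzspan X"

text \<open>
  Since the supports of a block sequence increase, the vectors supported above a finite
  set \<open>S\<close> form the tail starting at the first such vector.  Then \<open>X/n\<close> is the case
  \<open>S = {n}\<close>, and \<open>X/a\<close> the case where \<open>S\<close> is the union of the entries of \<open>a\<close>;
  in particular \<open>X/[] = X\<close>.
\<close>

definition tail_above :: "(nat \<Rightarrow> 'v) \<Rightarrow> nat set \<Rightarrow> nat \<Rightarrow> 'v" where
  "tail_above X S = (\<lambda>i. X (i + (LEAST k. \<forall>s\<in>S. \<forall>j\<in>supp (X k). s < j)))"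

definition tail_nat :: "(nat \<Rightarrow> 'v) \<Rightarrow> nat \<Rightarrow> nat \<Rightarrow> 'v" where
  "tail_nat X n = tail_above X {n}"

definition tail_fin :: "(nat \<Rightarrow> 'v) \<Rightarrow> nat set list \<Rightarrow> nat \<Rightarrow> 'v" where
  "tail_fin X a = tail_above X (\<Union>(set a))"

definition block_le_star :: "(nat \<Rightarrow> 'v) \<Rightarrow> (nat \<Rightarrow> 'v) \<Rightarrow> bool" (infix "\<preceq>\<^sup>*" 50) where
  "Y \<preceq>\<^sup>* X \<longleftrightarrow> (\<exists>n. tail_nat Y n \<preceq> X)"

definition supp_initial :: "nat set list \<Rightarrow> (nat \<Rightarrow> 'v) \<Rightarrow> bool" where
  "supp_initial a X \<longleftrightarrow> a = map (\<lambda>i. supp (X i)) [0..<length a]"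

definition infinite_dimensional :: "'v set \<Rightarrow> bool" where
  "infinite_dimensional V \<longleftrightarrow> (\<nexists>B. finite B \<and> independent B \<and> span B = V)"

definition finite_codimensional :: "'v set \<Rightarrow> bool" where
  "finite_codimensional W \<longleftrightarrow> (\<exists>B. finite B \<and> span (W \<union> B) = UNIV)"

definition vfilter :: "'v set set \<Rightarrow> bool" where
  "vfilter \<F> \<longleftrightarrow>
     (\<forall>A\<in>\<F>. A \<subseteq> UNIV - {0}) \<and>
     UNIV - {0} \<in> \<F> \<and>
     {} \<notin> \<F> \<and>
     (\<forall>A\<in>\<F>. \<forall>B\<in>\<F>. A \<inter> B \<in> \<F>) \<and>
     (\<forall>A\<in>\<F>. \<forall>B. A \<subseteq> B \<and> B \<subseteq> UNIV - {0} \<longrightarrow> B \<in> \<F>) \<and>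
     (\<forall>W. subspace W \<and> finite_codimensional W \<longrightarrow> W - {0} \<in> \<F>)"

definition block_filter :: "'v set set \<Rightarrow> bool" where
  "block_filter \<F> \<longleftrightarrow>
     vfilter \<F> \<and> (\<forall>A\<in>\<F>. \<exists>X\<in>block_seqs. nzspan X \<in> \<F> \<and> nzspan X \<subseteq> A)"

definition filter_dense :: "'v set set \<Rightarrow> 'v set \<Rightarrow> bool" where
  "filter_dense \<F> D \<longleftrightarrow>
     (\<forall>X\<in>block_seqs. nzspan X \<in> \<F> \<longrightarrow>
        (\<exists>V. subspace V \<and> infinite_dimensional V \<and> V \<subseteq> nzspan X \<union> {0} \<and> V - {0} \<subseteq> D))"

text \<open>
  Density ignores whether \<open>D\<close> contains \<open>0\<close>, whereas members of a filter never do;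
  hence \<open>0\<close> is removed from \<open>D\<close> below.
\<close>

definition full_filter :: "'v set set \<Rightarrow> bool" where
  "full_filter \<F> \<longleftrightarrow> (\<forall>D. filter_dense \<F> D \<longrightarrow> D - {0} \<in> \<F>)"

definition p_filter :: "'v set set \<Rightarrow> bool" where
  "p_filter \<F> \<longleftrightarrow>
     block_filter \<F> \<and>
     (\<forall>Xs :: nat \<Rightarrow> nat \<Rightarrow> 'v.
        (\<forall>n. Xs n \<in> block_seqs \<and> nzspan (Xs n) \<in> \<F>) \<longrightarrow>
        (\<exists>X\<in>block_seqs. nzspan X \<in> \<F> \<and> (\<forall>n. X \<preceq>\<^sup>* Xs n)))"

definition p_plus_filter :: "'v set set \<Rightarrow> bool" where
  "p_plus_filter \<F> \<longleftrightarrow> p_filter \<F> \<and> full_filter \<F>"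

end

definition FIN :: "nat set set" where
  "FIN = {a. finite a \<and> a \<noteq> {}}"

definition FIN_seqs :: "nat set list set" where
  "FIN_seqs = {a. set a \<subseteq> FIN \<and> (\<forall>i. Suc i < length a \<longrightarrow> Max (a ! i) < Min (a ! Suc i))}"

end

theory Submission
  imports Defs
begin

text \<open>
  Only finitely many \<open>a \<in> FIN_seqs\<close> have all entries contained in \<open>{..m}\<close>, so the
  \<open>(p)\<close>-property yields one \<open>X\<close> in the filter and a monotone \<open>f\<close> such that every vector of
  \<open>\<langle>X\<rangle>\<close> supported above \<open>f m\<close> lies in \<open>\<langle>Xa a\<rangle>\<close> for all these \<open>a\<close>. It remains to thin \<open>X\<close>
  out, within the filter, to a block sequence \<open>Z\<close> whose consecutive supports are separated
  by gaps that are large with respect to \<open>f\<close>.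

  This is a parity argument. Call \<open>i \<in> S\<close> a jump of \<open>S\<close> if all larger elements of \<open>S\<close> exceed
  \<open>f i\<close>. For \<open>S\<close> below \<open>T\<close>, the numbers of jumps add up if the gap between \<open>S\<close> and \<open>T\<close> is
  large, and exactly one jump, the maximum of \<open>S\<close>, is lost if it is small. Hence the set
  \<open>D\<close> of vectors whose support has an even number of jumps is dense (two vectors with odd
  counts and a large gap in between have a sum in \<open>D\<close>), so \<open>D\<close> belongs to the filter by
  fullness, while any block sequence spanning a subset of \<open>D\<close> has only large gaps.
\<close>

section \<open>Jump counts of finite sets\<close>

definition jumps :: "(nat \<Rightarrow> nat) \<Rightarrow> nat set \<Rightarrow> nat set" where
  "jumps f S = {i\<in>S. \<forall>k\<in>S. i < k \<longrightarrow> f i < k}"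

text \<open>An element of \<open>S\<close> below its maximum \<open>m\<close> has \<open>m\<close>
  as a larger element lying before all of \<open>T\<close>, so adding \<open>T\<close> does not
  affect whether it is a jump; an element of \<open>T\<close> sees only \<open>T\<close>. Thus only
  the status of \<open>m\<close> can change.\<close>

lemma even_card_jumps_Un:
  assumes "mono f" "finite S" "finite T" and less: "\<forall>i\<in>S. \<forall>j\<in>T. i < j"
  shows "even (card (jumps f (S \<union> T))) \<longleftrightarrow>
    ((even (card (jumps f S)) \<longleftrightarrow> even (card (jumps f T))) \<longleftrightarrow> (\<forall>i\<in>S. \<forall>j\<in>T. f i < j))"
proof (cases "S = {}")
  case True
  then show ?thesis by (simp add: jumps_def)
next
  case False
  define m where "m = Max S"
  have m: "m \<in> S" "\<And>i. i \<in> S \<Longrightarrow> i \<le> m"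
    using assms False by (auto simp: m_def)
  \<comment> \<open>By monotonicity of \<open>f\<close> the whole gap is decided at the maximum of
    \<open>S\<close>.\<close>
  have large_iff: "(\<forall>i\<in>S. \<forall>j\<in>T. f i < j) \<longleftrightarrow> (\<forall>j\<in>T. f m < j)"
    using m \<open>mono f\<close> by (meson le_less_trans monoD)
  have fin: "finite (jumps f S)" "finite (jumps f T)"
    using assms by (auto simp: jumps_def)
  \<comment> \<open>The maximum is vacuously a jump of \<open>S\<close> on its own, so exactly one
    jump is lost when the gap is small.\<close>
  have mS: "m \<in> jumps f S"
    using m by (fastforce simp: jumps_def)
  have disj: "jumps f S \<inter> jumps f T = {}"
    using less by (auto simp: jumps_def)
  have inS: "i \<in> jumps f (S \<union> T) \<longleftrightarrow> i \<in> jumps f S \<and> (i = m \<longrightarrow> (\<forall>j\<in>T. f m < j))"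
    if "i \<in> S" for i
  proof (cases "i = m")
    case True
    with m mS less show ?thesis by (auto simp: jumps_def)
  next
    case False
    with that m have "i < m" by (simp add: order_less_le)
    with that m less show ?thesis
      by (auto simp: jumps_def) (meson less_trans)
  qed
  have inT: "i \<in> jumps f (S \<union> T) \<longleftrightarrow> i \<in> jumps f T" if "i \<in> T" for i
    using that less by (auto simp: jumps_def dest: less_asym)
  have sub: "jumps f S \<subseteq> S" "jumps f T \<subseteq> T" "jumps f (S \<union> T) \<subseteq> S \<union> T"
    by (auto simp: jumps_def)
  show ?thesis
  proof (cases "\<forall>j\<in>T. f m < j")
    case True
    then have "jumps f (S \<union> T) = jumps f S \<union> jumps f T"
      using inS inT sub by blast
    then show ?thesis
      using True large_iff fin disj by (simp add: card_Un_disjoint)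
  next
    case False
    have "i \<in> jumps f (S \<union> T) \<longleftrightarrow> i \<in> (jumps f S - {m}) \<union> jumps f T" for i
      using False inS[of i] inT[of i] sub m(1) less by (cases "i \<in> S"; cases "i \<in> T") auto
    then have "jumps f (S \<union> T) = (jumps f S - {m}) \<union> jumps f T"
      by blast
    moreover have "(jumps f S - {m}) \<inter> jumps f T = {}"
      using disj by blast
    ultimately have "card (jumps f (S \<union> T)) = card (jumps f S - {m}) + card (jumps f T)"
      using fin by (simp add: card_Un_disjoint)
    moreover have "card (jumps f S) = Suc (card (jumps f S - {m}))"
      using fin(1) mS by (rule card.remove)
    ultimately show ?thesis
      using False large_iff by auto
  qed
qed

text \<open>The maxima of the entries strictly increase, so the entries are distinct, and a finite
  set has only finitely many repetition-free lists of subsets.\<close>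

lemma finite_FIN_seqs_bounded: "finite {a \<in> FIN_seqs. \<Union>(set a) \<subseteq> {..m}}"
proof (rule finite_subset)
  show "finite {a. set a \<subseteq> Pow {..m} \<and> distinct a}"
    by (rule finite_subset_distinct) simp
  have "distinct a" if a: "a \<in> FIN_seqs" for a
  proof -
    have "Max (a ! i) < Max (a ! Suc i)" if "Suc i < length a" for i
    proof -
      have "a ! Suc i \<in> set a"
        using that by simp
      then have "finite (a ! Suc i)" "a ! Suc i \<noteq> {}"
        using a unfolding FIN_seqs_def FIN_def by blast+
      then have "Min (a ! Suc i) \<le> Max (a ! Suc i)"
        by simp
      then show ?thesis
        using a that unfolding FIN_seqs_def by fastforce
    qed
    then have "sorted_wrt (<) (map Max a)"
      by (auto simp: sorted_wrt_iff_nth_Suc_transp)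
    then have "distinct (map Max a)"
      by (simp add: strict_sorted_iff)
    then show ?thesis
      by (simp add: distinct_map)
  qed
  then show "{a \<in> FIN_seqs. \<Union>(set a) \<subseteq> {..m}} \<subseteq> {a. set a \<subseteq> Pow {..m} \<and> distinct a}"
    by auto
qed

context block_space
begin

section \<open>Supports of vectors\<close>

lemma finite_supp: "finite (supp v)"
proof -
  have "finite {b. representation (range e) v b \<noteq> 0}"
    by (rule finite_representation)
  then have "finite (e -` {b. representation (range e) v b \<noteq> 0})"
    using inj_basis by (rule finite_vimageI)
  then show ?thesis
    by (simp add: supp_def vimage_def)
qed

lemma supp_zero [simp]: "supp 0 = {}"
  by (simp add: supp_def representation_zero)

lemma supp_eq_empty_iff [simp]: "supp v = {} \<longleftrightarrow> v = 0"
proof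
  assume "supp v = {}"
  then have "representation (range e) v b = 0" for b
    using representation_ne_zero[of "range e" v b] by (auto simp: supp_def)
  then show "v = 0"
    using sum_nonzero_representation_eq[OF independent_basis, of v] span_basis by simp
qed simp

lemma supp_add_subset: "supp (u + v) \<subseteq> supp u \<union> supp v"
  using span_basis independent_basis by (auto simp: supp_def representation_add)

lemma supp_add_disjoint: "supp u \<inter> supp v = {} \<Longrightarrow> supp (u + v) = supp u \<union> supp v"
  using span_basis independent_basis by (auto simp: supp_def representation_add disjoint_iff) (metis add_0)

lemma supp_scale: "c \<noteq> 0 \<Longrightarrow> supp (scale c v) = supp v"
  using span_basis independent_basis by (auto simp: supp_def representation_scale)

lemma supp_scale_subset: "supp (scale c v) \<subseteq> supp v"
  by (cases "c = 0") (auto simp: supp_scale)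

lemma subspace_supp_subset: "subspace {v. supp v \<subseteq> S}"
proof (rule subspaceI)
  show "u + v \<in> {v. supp v \<subseteq> S}" if "u \<in> {v. supp v \<subseteq> S}" "v \<in> {v. supp v \<subseteq> S}" for u v
    using that supp_add_subset[of u v] by blast
  show "scale c v \<in> {v. supp v \<subseteq> S}" if "v \<in> {v. supp v \<subseteq> S}" for c v
    using that supp_scale_subset[of c v] by blast
qed simp

lemma supp_span_subset: "v \<in> span B \<Longrightarrow> supp v \<subseteq> (\<Union>b\<in>B. supp b)"
  using span_minimal[OF _ subspace_supp_subset, of B "\<Union>b\<in>B. supp b"] by blast

section \<open>Block sequences and their spans\<close>

lemma block_seqs_iff:
  "X \<in> block_seqs \<longleftrightarrow>
    (\<forall>n. X n \<noteq> 0) \<and> (\<forall>n. \<forall>i\<in>supp (X n). \<forall>j\<in>supp (X (Suc n)). i < j)"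
  \<comment> \<open>Supports of nonzero vectors are finite and nonempty, so comparing
    \<open>Max\<close> with \<open>Min\<close> is the same as comparing all elements.\<close>
  unfolding block_seqs_def using finite_supp by auto

lemma block_seq_less:
  assumes "X \<in> block_seqs" "m < n" "i \<in> supp (X m)" "j \<in> supp (X n)"
  shows "i < j"
  using assms(2,4)
proof (induction n arbitrary: j)
  case (Suc n)
  obtain k where k: "k \<in> supp (X n)"
    using assms(1) by (metis block_seqs_iff ex_in_conv supp_eq_empty_iff)
  then have "k < j"
    using assms(1) Suc.prems block_seqs_iff by blast
  show ?case
  proof (cases "m = n")
    case True
    with Suc.prems assms(1,3) show ?thesis by (auto simp: block_seqs_iff)
  next
    case False
    with Suc.IH[OF _ k] Suc.prems \<open>k < j\<close> show ?thesis by simp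
  qed
qed simp

text \<open>Minima of supports increase strictly from at least 0. The bound shows that blocks
  eventually pass every finite set, and it serves below to choose blocks far enough out.\<close>

lemma block_seq_le_supp:
  assumes "X \<in> block_seqs" "j \<in> supp (X n)"
  shows "n \<le> j"
  using assms(2)
proof (induction n arbitrary: j)
  case (Suc n)
  obtain k where k: "k \<in> supp (X n)"
    using assms(1) by (metis block_seqs_iff ex_in_conv supp_eq_empty_iff)
  then have "k < j"
    using assms(1) Suc.prems block_seqs_iff by blast
  with Suc.IH[OF k] show ?case by simp
qed simp

lemma span_range_initial:
  fixes X :: "nat \<Rightarrow> 'v"
  assumes "v \<in> span (range X)"
  obtains N where "v \<in> span (X ` {..<N})"
proof -
  from assms obtain t r where t: "finite t" "t \<subseteq> range X" "v = (\<Sum>a\<in>t. scale (r a) a)"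
    unfolding span_explicit by blast
  then obtain I where I: "finite I" "t = X ` I"
    by (meson finite_subset_image)
  from I(1) obtain N where "I \<subseteq> {..<N}"
    using finite_nat_iff_bounded by blast
  then have "t \<subseteq> X ` {..<N}"
    using I by blast
  moreover have "v \<in> span t"
    unfolding t(3) by (intro span_sum span_scale span_base)
  ultimately show thesis
    using that span_mono by blast
qed

lemma block_span_less:
  assumes X: "X \<in> block_seqs" and u: "u \<in> span (X ` {..<N})" and "N \<le> n"
    and i: "i \<in> supp u" and j: "j \<in> supp (X n)"
  shows "i < j"
proof -
  obtain k where "k < N" "i \<in> supp (X k)"
    using supp_span_subset[OF u] i by blast
  with block_seq_less[OF X _ _ j, of k i] \<open>N \<le> n\<close> show ?thesis
    by simp
qed

text \<open>Strips off the last block occurring in a combination. Scalars are forgotten and only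
  supports are kept, which suffices because jump counts depend on supports alone.\<close>

lemma block_span_induct [consumes 2, case_names zero tail add]:
  assumes "X \<in> block_seqs" "v \<in> span (X ` {..<N})"
    and "P 0"
    and tail: "\<And>n v. n < N \<Longrightarrow> supp v = supp (X n) \<Longrightarrow> P v"
    and add: "\<And>n u v. n < N \<Longrightarrow> u \<noteq> 0 \<Longrightarrow> u \<in> span (X ` {..<n}) \<Longrightarrow> P u \<Longrightarrow>
      supp v = supp u \<union> supp (X n) \<Longrightarrow> P v"
  shows "P v"
  using assms(2) tail add
proof (induction N arbitrary: v)
  case 0
  then show ?case using \<open>P 0\<close> by simp
next
  case (Suc N)
  from Suc.prems(1) obtain c where "v - scale c (X N) \<in> span (X ` {..<N})"
    using span_breakdown_eq by (auto simp: lessThan_Suc)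
  then obtain u where u: "u \<in> span (X ` {..<N})" "v = u + scale c (X N)"
    by (metis diff_add_cancel)
  have "P u"
    using Suc.IH[OF u(1)] Suc.prems(2,3) by (meson less_SucI)
  consider "c = 0" | "c \<noteq> 0" "u = 0" | "c \<noteq> 0" "u \<noteq> 0" by blast
  then show ?case
  proof cases
    case 1
    with u \<open>P u\<close> show ?thesis by simp
  next
    case 2
    with u Suc.prems(2)[of N] show ?thesis by (simp add: supp_scale)
  next
    case 3
    have "supp u \<inter> supp (X N) = {}"
      using block_span_less[OF assms(1) u(1) order_refl] by blast
    with 3 u have "supp v = supp u \<union> supp (X N)"
      by (simp add: supp_add_disjoint supp_scale)
    with 3 u \<open>P u\<close> Suc.prems(3) show ?thesis by blast
  qed
qed

text \<open>Blocks have disjoint supports, so nothing cancels in a combination.\<close>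

lemma block_span_contains_supp:
  assumes "X \<in> block_seqs" "v \<in> span (X ` {..<N})" "v \<noteq> 0"
  shows "\<exists>k<N. supp (X k) \<subseteq> supp v"
  using assms by (induction v rule: block_span_induct) auto

text \<open>A finite spanning set would keep all supports below some \<open>N\<close>, whereas the
  support of \<open>X N\<close> starts at \<open>N\<close> or later.\<close>

lemma infinite_dimensional_block_span:
  assumes "X \<in> block_seqs"
  shows "infinite_dimensional (span (range X))"
  unfolding infinite_dimensional_def
proof
  assume "\<exists>B. finite B \<and> independent B \<and> span B = span (range X)"
  then obtain B where B: "finite B" "span B = span (range X)" by blast
  then have "finite (\<Union>b\<in>B. supp b)"
    using finite_supp by blast
  then obtain N where N: "(\<Union>b\<in>B. supp b) \<subseteq> {..<N}"
    using finite_nat_iff_bounded by blast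
  have "X N \<in> span B"
    using B by (simp add: span_base)
  then have "supp (X N) \<subseteq> {..<N}"
    using supp_span_subset N by blast
  moreover have "supp (X N) \<noteq> {}"
    using assms by (simp add: block_seqs_iff)
  ultimately show False
    using block_seq_le_supp[OF assms] by fastforce
qed

section \<open>Tails of block sequences\<close>

lemma tail_above_props:
  assumes "X \<in> block_seqs" "finite S"
  obtains k where "tail_above X S = (\<lambda>i. X (i + k))" "\<forall>s\<in>S. \<forall>j\<in>supp (X k). s < j"
    "\<And>l. l < k \<Longrightarrow> \<not> (\<forall>s\<in>S. \<forall>j\<in>supp (X l). s < j)"
proof -
  define P where "P k \<longleftrightarrow> (\<forall>s\<in>S. \<forall>j\<in>supp (X k). s < j)" for k
  obtain N where "S \<subseteq> {..<N}"
    using \<open>finite S\<close> finite_nat_iff_bounded by blast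
  then have "P N"
    using block_seq_le_supp[OF assms(1)] unfolding P_def by fastforce
  then have "P (LEAST k. P k)" by (rule LeastI)
  moreover have "\<not> P l" if "l < (LEAST k. P k)" for l
    using that by (rule not_less_Least)
  moreover have "tail_above X S = (\<lambda>i. X (i + (LEAST k. P k)))"
    by (simp only: tail_above_def P_def)
  ultimately show thesis
    unfolding P_def by (rule that[rotated])
qed

text \<open>Split \<open>v\<close> into a part \<open>u\<close> from the dropped blocks and a part
  \<open>t\<close> from the tail. A nonzero \<open>u\<close> would put the whole support of some
  dropped block into \<open>supp v\<close>, hence above \<open>n\<close>, against the minimality of
  the starting index.\<close>

lemma in_span_tail_nat:
  assumes X: "X \<in> block_seqs" and v: "v \<in> span (range X)" "\<forall>j\<in>supp v. n < j"
  shows "v \<in> span (range (tail_nat X n))"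
proof -
  have "finite {n}" by simp
  with X obtain k where "tail_above X {n} = (\<lambda>i. X (i + k))"
    "\<And>l. l < k \<Longrightarrow> \<not> (\<forall>s\<in>{n}. \<forall>j\<in>supp (X l). s < j)"
    by (rule tail_above_props) blast
  then have k: "tail_nat X n = (\<lambda>i. X (i + k))"
    "\<And>l. l < k \<Longrightarrow> \<not> (\<forall>j\<in>supp (X l). n < j)"
    by (simp_all add: tail_nat_def)
  have "range X \<subseteq> X ` {..<k} \<union> range (tail_nat X n)"
  proof
    fix x assume "x \<in> range X"
    then obtain i where "x = X i" by blast
    then show "x \<in> X ` {..<k} \<union> range (tail_nat X n)"
      unfolding k(1) by (cases "i < k") (auto simp: image_iff intro: exI[of _ "i - k"])
  qed
  then have "v \<in> span (X ` {..<k} \<union> range (tail_nat X n))"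
    using v(1) span_mono by blast
  then obtain u t where ut: "u \<in> span (X ` {..<k})" "t \<in> span (range (tail_nat X n))" "v = u + t"
    unfolding span_Un by blast
  have "u = 0"
  proof (rule ccontr)
    assume "u \<noteq> 0"
    then obtain l where l: "l < k" "supp (X l) \<subseteq> supp u"
      using block_span_contains_supp[OF X ut(1)] by blast
    have "supp u \<inter> supp t = {}"
      using supp_span_subset[OF ut(2)] block_span_less[OF X ut(1) le_add2]
      unfolding k(1) by blast
    then have "supp (X l) \<subseteq> supp v"
      using l ut(3) by (auto simp: supp_add_disjoint)
    then show False
      using k(2)[OF l(1)] v(2) by blast
  qed
  with ut show ?thesis by simp
qed

section \<open>Vectors with an even number of jumps\<close>

lemma even_jumps_span:
  assumes f: "mono f" and X: "X \<in> block_seqs"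
    and even: "\<And>n. even (card (jumps f (supp (X n))))"
    and gap: "\<And>n i j. i \<in> supp (X n) \<Longrightarrow> j \<in> supp (X (Suc n)) \<Longrightarrow> f i < j"
    and v: "v \<in> span (range X)"
  shows "even (card (jumps f (supp v)))"
proof -
  \<comment> \<open>Between non-consecutive blocks, \<open>f i\<close> is already passed by the
    block right after the first one.\<close>
  have gap': "f i < j" if "m < n" "i \<in> supp (X m)" "j \<in> supp (X n)" for m n i j
  proof (cases "n = Suc m")
    case False
    obtain l where l: "l \<in> supp (X (Suc m))"
      using X by (metis block_seqs_iff ex_in_conv supp_eq_empty_iff)
    then have "f i < l" "l < j"
      using that False gap block_seq_less[OF X, of "Suc m" n l j] by auto
    then show ?thesis by simp
  qed (use that gap in blast)
  obtain N where "v \<in> span (X ` {..<N})"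
    using v by (rule span_range_initial)
  with X show ?thesis
  \<comment> \<open>All gaps are large, so appending a block adds its even count and preserves
    parity.\<close>
  proof (induction v rule: block_span_induct)
    case zero
    then show ?case by (simp add: jumps_def)
  next
    case (tail n v)
    then show ?case using even by simp
  next
    case (add n u v)
    have "\<forall>i\<in>supp u. \<forall>j\<in>supp (X n). i < j"
      using block_span_less[OF X add(3) order_refl] by blast
    moreover have "\<forall>i\<in>supp u. \<forall>j\<in>supp (X n). f i < j"
      using supp_span_subset[OF add(3)] gap' by blast
    ultimately show ?case
      using add even by (simp add: even_card_jumps_Un f finite_supp)
  qed
qed

lemma filter_dense_even_jumps:
  assumes f: "mono f"
  shows "filter_dense \<F> {v. even (card (jumps f (supp v)))}"
  unfolding filter_dense_def
proof (intro ballI impI)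
  fix X assume X: "X \<in> block_seqs"
  define P where
    "P v \<longleftrightarrow> v \<in> span (range X) \<and> v \<noteq> 0 \<and> even (card (jumps f (supp v)))" for v
  have P_above: "\<exists>v. P v \<and> (\<forall>j\<in>supp v. m < j)" for m
  proof (cases "\<exists>k>m. even (card (jumps f (supp (X k))))")
    case True
    then obtain k where "k > m" "even (card (jumps f (supp (X k))))" by blast
    moreover have "\<forall>j\<in>supp (X k). m < j"
      using block_seq_le_supp[OF X] \<open>k > m\<close> by fastforce
    ultimately show ?thesis
      using X by (intro exI[of _ "X k"]) (simp add: P_def span_base block_seqs_iff)
  next
    case False
    \<comment> \<open>Every block of index above \<open>m\<close> has an odd count here, so two of
      them with a large gap in between have a sum with even count.\<close>
    define k where "k = Suc m"
    obtain N where N: "f ` supp (X k) \<subseteq> {..<N}"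
      using finite_supp finite_nat_iff_bounded by blast
    \<comment> \<open>The support of \<open>X l\<close> starts at \<open>l\<close> or later: the
      bound \<open>N\<close> puts it beyond the values of \<open>f\<close> on
      \<open>supp (X k)\<close>, and \<open>Suc k\<close> keeps the two blocks in order.\<close>
    define l where "l = max (Suc k) N"
    have kl: "m < k" "k < l" "N \<le> l"
      by (auto simp: k_def l_def)
    have less: "\<forall>i\<in>supp (X k). \<forall>j\<in>supp (X l). i < j"
      using block_seq_less[OF X \<open>k < l\<close>] by blast
    have gap: "\<forall>i\<in>supp (X k). \<forall>j\<in>supp (X l). f i < j"
      using N kl block_seq_le_supp[OF X, of _ l] by fastforce
    have supp: "supp (X k + X l) = supp (X k) \<union> supp (X l)"
      using less by (intro supp_add_disjoint) blast
    have "even (card (jumps f (supp (X k + X l))))"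
      using False kl less gap by (simp add: supp even_card_jumps_Un f finite_supp)
    moreover have "X k + X l \<noteq> 0"
      using supp X by (metis Un_empty block_seqs_iff supp_eq_empty_iff)
    moreover have "\<forall>j\<in>supp (X k + X l). m < j"
      using supp kl block_seq_le_supp[OF X] by fastforce
    ultimately show ?thesis
      by (intro exI[of _ "X k + X l"]) (simp add: P_def span_add span_base)
  qed
  \<comment> \<open>Even vectors are chosen one after another with large gaps, so that the entire
    span of \<open>Y\<close> stays even.\<close>
  have "\<exists>Y. \<forall>n. P (Y n) \<and> (\<forall>i\<in>supp (Y n). \<forall>j\<in>supp (Y (Suc n)). i < j \<and> f i < j)"
  proof (rule dependent_nat_choice)
    show "\<exists>v. P v" using P_above by blast
  next
    fix u and n :: nat
    have "finite (supp u \<union> f ` supp u)"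
      using finite_supp by blast
    then obtain N where N: "supp u \<union> f ` supp u \<subseteq> {..<N}"
      using finite_nat_iff_bounded by blast
    obtain v where v: "P v" "\<forall>j\<in>supp v. N < j"
      using P_above by blast
    with N have "\<forall>i\<in>supp u. \<forall>j\<in>supp v. i < j \<and> f i < j"
      by fastforce
    with v show "\<exists>v. P v \<and> (\<forall>i\<in>supp u. \<forall>j\<in>supp v. i < j \<and> f i < j)"
      by blast
  qed
  then obtain Y where Y: "\<And>n. P (Y n)"
    "\<And>n i j. i \<in> supp (Y n) \<Longrightarrow> j \<in> supp (Y (Suc n)) \<Longrightarrow> i < j \<and> f i < j"
    by blast
  have "Y \<in> block_seqs"
    using Y by (auto simp: block_seqs_iff P_def)
  moreover from this have "even (card (jumps f (supp v)))" if "v \<in> span (range Y)" for v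
    using even_jumps_span[OF f, of Y v] Y that by (auto simp: P_def)
  moreover have "span (range Y) \<subseteq> span (range X)"
    using Y(1) by (intro span_minimal) (auto simp: P_def)
  ultimately show "\<exists>V. subspace V \<and> infinite_dimensional V \<and> V \<subseteq> nzspan X \<union> {0} \<and>
      V - {0} \<subseteq> {v. even (card (jumps f (supp v)))}"
    by (intro exI[of _ "span (range Y)"])
      (auto simp: infinite_dimensional_block_span nzspan_def)
qed

section \<open>Diagonalization in the filter\<close>

lemma vfilter_Int: "vfilter \<F> \<Longrightarrow> A \<in> \<F> \<Longrightarrow> B \<in> \<F> \<Longrightarrow> A \<inter> B \<in> \<F>"
  unfolding vfilter_def by blast

text \<open>The factor \<open>UNIV - {0}\<close> is the value for empty \<open>A\<close>, since
  members of a filter omit 0.\<close>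

lemma vfilter_finite_Inter:
  assumes "vfilter \<F>" "finite A" "\<And>a. a \<in> A \<Longrightarrow> G a \<in> \<F>"
  shows "(UNIV - {0}) \<inter> (\<Inter>a\<in>A. G a) \<in> \<F>"
  using assms(2,3)
proof (induction A rule: finite_induct)
  case empty
  then show ?case using assms(1) by (simp add: vfilter_def)
next
  case (insert a A)
  then have "G a \<inter> ((UNIV - {0}) \<inter> (\<Inter>a\<in>A. G a)) \<in> \<F>"
    by (blast intro: vfilter_Int[OF assms(1)])
  moreover have "G a \<inter> ((UNIV - {0}) \<inter> (\<Inter>a\<in>A. G a)) =
      (UNIV - {0}) \<inter> (\<Inter>a\<in>insert a A. G a)"
    by auto
  ultimately show ?case by simp
qed

text \<open>For each \<open>m\<close> a block sequence \<open>Y m\<close> is taken inside the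
  finitely many \<open>nzspan (Xa a)\<close> with \<open>a\<close> bounded by \<open>m\<close>. The
  (p)-property applied to \<open>Y\<close> gives \<open>X\<close>, and \<open>f\<close> records
  where its tails enter.\<close>

lemma p_filter_bounded_absorption:
  assumes "p_filter \<F>" "\<And>a. a \<in> FIN_seqs \<Longrightarrow> nzspan (Xa a) \<in> \<F>"
  obtains X f where "X \<in> block_seqs" "nzspan X \<in> \<F>" "mono (f :: nat \<Rightarrow> nat)"
    "\<And>a m v. a \<in> FIN_seqs \<Longrightarrow> \<Union>(set a) \<subseteq> {..m} \<Longrightarrow> v \<in> nzspan X \<Longrightarrow>
      \<forall>j\<in>supp v. f m < j \<Longrightarrow> v \<in> nzspan (Xa a)"
proof -
  have vf: "vfilter \<F>" and base: "\<And>A. A \<in> \<F> \<Longrightarrow> \<exists>X\<in>block_seqs. nzspan X \<in> \<F> \<and> nzspan X \<subseteq> A"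
    using assms(1) by (auto simp: p_filter_def block_filter_def)
  have "\<exists>Y\<in>block_seqs. nzspan Y \<in> \<F> \<and>
      nzspan Y \<subseteq> (UNIV - {0}) \<inter> (\<Inter>a\<in>{a \<in> FIN_seqs. \<Union>(set a) \<subseteq> {..m}}. nzspan (Xa a))" for m
    by (intro base vfilter_finite_Inter vf finite_FIN_seqs_bounded) (use assms(2) in auto)
  then obtain Y where Y: "\<And>m. Y m \<in> block_seqs" "\<And>m. nzspan (Y m) \<in> \<F>"
    "\<And>m a. a \<in> FIN_seqs \<Longrightarrow> \<Union>(set a) \<subseteq> {..m} \<Longrightarrow> nzspan (Y m) \<subseteq> nzspan (Xa a)"
    by (simp add: subset_iff) metis
  then obtain X where X: "X \<in> block_seqs" "nzspan X \<in> \<F>" "\<And>m. X \<preceq>\<^sup>* Y m"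
    using assms(1) unfolding p_filter_def by meson
  then obtain g where g: "\<And>m. tail_nat X (g m) \<preceq> Y m"
    unfolding block_le_star_def by metis
  \<comment> \<open>Partial sums turn the thresholds \<open>g\<close> into a monotone function
    dominating them.\<close>
  define f where "f m = (\<Sum>i\<le>m. g i)" for m
  have "mono f"
    unfolding f_def by (intro monoI sum_mono2) auto
  have g_le: "g m \<le> f m" for m
    unfolding f_def by (rule member_le_sum) auto
  have "v \<in> nzspan (Xa a)"
    if "a \<in> FIN_seqs" "\<Union>(set a) \<subseteq> {..m}" "v \<in> nzspan X" "\<forall>j\<in>supp v. f m < j" for a m v
  proof -
    have "v \<in> span (range (tail_nat X (g m)))"
      using that g_le[of m] by (intro in_span_tail_nat X) (auto simp: nzspan_def)
    then have "v \<in> nzspan (Y m)"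
      using g[of m] that(3) by (auto simp: block_le_def nzspan_def)
    then show ?thesis
      using Y(3) that by blast
  qed
  with X \<open>mono f\<close> show thesis
    using that by blast
qed

lemma p_plus_filter_diagonal:
  assumes F: "p_plus_filter \<F>" and Xa: "\<And>a. a \<in> FIN_seqs \<Longrightarrow> nzspan (Xa a) \<in> \<F>"
  shows "\<exists>Z\<in>block_seqs. nzspan Z \<in> \<F> \<and>
    (\<forall>a\<in>FIN_seqs. supp_initial a Z \<longrightarrow> tail_fin Z a \<preceq> Xa a)"
proof -
  have pf: "p_filter \<F>" and full: "full_filter \<F>"
    using F by (auto simp: p_plus_filter_def)
  have vf: "vfilter \<F>" and base: "\<And>A. A \<in> \<F> \<Longrightarrow> \<exists>X\<in>block_seqs. nzspan X \<in> \<F> \<and> nzspan X \<subseteq> A"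
    using pf by (auto simp: p_filter_def block_filter_def)
  obtain X f where X: "X \<in> block_seqs" "nzspan X \<in> \<F>" and f: "mono (f :: nat \<Rightarrow> nat)"
    and absorb: "\<And>a m v. a \<in> FIN_seqs \<Longrightarrow> \<Union>(set a) \<subseteq> {..m} \<Longrightarrow> v \<in> nzspan X \<Longrightarrow>
      \<forall>j\<in>supp v. f m < j \<Longrightarrow> v \<in> nzspan (Xa a)"
    using p_filter_bounded_absorption[of \<F> Xa, OF pf Xa] by blast
  define D where "D = {v. even (card (jumps f (supp v)))}"
  have "D - {0} \<in> \<F>"
    using full filter_dense_even_jumps[OF f] by (simp add: full_filter_def D_def)
  moreover have "[] \<in> FIN_seqs"
    by (simp add: FIN_seqs_def)
  \<comment> \<open>The set for \<open>[]\<close> is included separately: the empty sequence has no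
    last block from which a gap could start.\<close>
  ultimately have "(D - {0}) \<inter> nzspan X \<inter> nzspan (Xa []) \<in> \<F>"
    using X Xa by (intro vfilter_Int[OF vf])
  then obtain Z where Z: "Z \<in> block_seqs" "nzspan Z \<in> \<F>"
    and ZD: "nzspan Z \<subseteq> D" and ZX: "nzspan Z \<subseteq> nzspan X" and Z0: "nzspan Z \<subseteq> nzspan (Xa [])"
    using base by blast
  have Zn: "Z n \<in> nzspan Z" for n
    using Z(1) by (simp add: nzspan_def span_base block_seqs_iff)
  \<comment> \<open>Two consecutive blocks and their sum all lie in \<open>D\<close>; with three
    even counts, the parity formula forces the gap to be large.\<close>
  have gap: "f i < j" if ij: "i \<in> supp (Z n)" "j \<in> supp (Z (Suc n))" for n i j
  proof -
    have less: "\<forall>i\<in>supp (Z n). \<forall>j\<in>supp (Z (Suc n)). i < j"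
      using Z(1) by (simp add: block_seqs_iff)
    then have supp: "supp (Z n + Z (Suc n)) = supp (Z n) \<union> supp (Z (Suc n))"
      by (intro supp_add_disjoint) blast
    then have "Z n + Z (Suc n) \<noteq> 0"
      using ij by (metis Un_iff empty_iff supp_zero)
    then have "Z n + Z (Suc n) \<in> nzspan Z"
      by (simp add: nzspan_def span_add span_base)
    then have "Z n + Z (Suc n) \<in> D" "Z n \<in> D" "Z (Suc n) \<in> D"
      using ZD Zn by auto
    then show ?thesis
      using even_card_jumps_Un[OF f finite_supp finite_supp less] ij by (simp add: D_def supp)
  qed
  have "tail_fin Z a \<preceq> Xa a" if a: "a \<in> FIN_seqs" "supp_initial a Z" for a
  proof -
    have setU: "\<Union>(set a) = (\<Union>i<length a. supp (Z i))"
      using a(2) unfolding supp_initial_def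
      by (metis atLeast_upt list.set_map)
    then have "finite (\<Union>(set a))"
      by (simp add: finite_supp)
    then obtain k where k: "tail_fin Z a = (\<lambda>i. Z (i + k))"
      "\<forall>s\<in>\<Union>(set a). \<forall>j\<in>supp (Z k). s < j"
      using tail_above_props[OF Z(1)] unfolding tail_fin_def by metis
    \<comment> \<open>No block listed in \<open>a\<close> lies above its own support, so the tail
      begins after all of them.\<close>
    have "length a \<le> k"
    proof (rule ccontr)
      assume "\<not> length a \<le> k"
      then have "supp (Z k) \<subseteq> \<Union>(set a)"
        using setU by auto
      moreover have "supp (Z k) \<noteq> {}"
        using Z(1) by (simp add: block_seqs_iff)
      ultimately show False
        using k(2) by blast
    qed
    have "Z n \<in> nzspan (Xa a)" if n: "length a \<le> n" for n
    proof (cases "length a")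
      case 0
      then show ?thesis using Zn Z0 by auto
    next
      case (Suc l)
      \<comment> \<open>The maximum of the last block listed in \<open>a\<close> bounds all entries
        of \<open>a\<close>. Every later block lies beyond \<open>f m\<close> by the gap after
        \<open>Z l\<close>, so it is absorbed by \<open>Xa a\<close>.\<close>
      define m where "m = Max (supp (Z l))"
      have m: "m \<in> supp (Z l)" "\<And>i. i \<in> supp (Z l) \<Longrightarrow> i \<le> m"
        using Z(1) finite_supp unfolding m_def by (auto simp: block_seqs_iff)
      have "i \<le> m" if "i \<in> supp (Z l')" "l' < Suc l" for i l'
        using that m block_seq_less[OF Z(1), of l' l i m] by (cases "l' = l") auto
      then have "\<Union>(set a) \<subseteq> {..m}"
        using setU Suc by auto
      moreover have "\<forall>j\<in>supp (Z n). f m < j"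
      proof
        fix j assume j: "j \<in> supp (Z n)"
        obtain i where i: "i \<in> supp (Z (Suc l))"
          using Z(1) by (metis block_seqs_iff ex_in_conv supp_eq_empty_iff)
        show "f m < j"
        proof (cases "n = Suc l")
          case True
          then show ?thesis using gap m j by blast
        next
          case False
          then have "i < j"
            using block_seq_less[OF Z(1) _ i j] n Suc by simp
          with gap[OF m(1) i] show ?thesis by simp
        qed
      qed
      ultimately show ?thesis
        using absorb a(1) Zn ZX by blast
    qed
    then have "range (tail_fin Z a) \<subseteq> span (range (Xa a))"
      using \<open>length a \<le> k\<close> unfolding k(1) nzspan_def by (auto simp: trans_le_add2)
    then show ?thesis
      unfolding block_le_def nzspan_def using span_minimal subspace_span by blast
  qed
  with Z show ?thesis by blast
qed

end

theorem theorem4p2: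
  fixes scale :: "'f::field \<Rightarrow> 'v::ab_group_add \<Rightarrow> 'v"
    and e :: "nat \<Rightarrow> 'v"
    and \<F> :: "'v set set"
    and Xa :: "nat set list \<Rightarrow> nat \<Rightarrow> 'v"
  assumes "block_space scale e"
    and "block_space.p_plus_filter scale e \<F>"
    and "\<And>a. a \<in> FIN_seqs \<Longrightarrow> Xa a \<in> block_space.block_seqs scale e"
    and "\<And>a. a \<in> FIN_seqs \<Longrightarrow> block_space.nzspan scale (Xa a) \<in> \<F>"
  shows "\<exists>X \<in> block_space.block_seqs scale e.
           block_space.nzspan scale X \<in> \<F> \<and>
           (\<forall>a \<in> FIN_seqs. block_space.supp_initial scale e a X \<longrightarrow>
              block_space.block_le scale (block_space.tail_fin scale e X a) (Xa a))"
  using block_space.p_plus_filter_diagonal[OF assms(1,2,4)] .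

end
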